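(* Let $\mathcal G=(V,E,\mathfrak c)$ be a countably infinite connected graph with conductances such that $\pi(x)=\sum_{y\sim x}\mathfrak c(x,y)<\infty$ for all $x\in V$. Let $\mathcal A\subset V$ be a non-empty finite set of vertices. For each $\phi:\mathcal A\to\mathbb R$, there exists a unique function $h^\phi:V\to\mathbb R$ such that $h^\phi|_{\mathcal A}=\phi$ and $\operatorname{Energy}(h^\phi)$ is minimal among all functions $f:V\to\mathbb R$ with $f|_{\mathcal A}=\phi$. This function $h^\phi$ is discrete harmonic on $V\setminus\mathcal A$ (i.e. at every $x\in V\setminus\mathcal A$) and has finite Dirichlet energy. Furthermore, the mapping $\phi\mapsto h^\phi$ is linear.
   Context: $\mathcal G=(V,E,\mathfrak c)$ is a graph with vertex set $V$, set $E$ of unoriented edges (unordered pairs of distinct vertices) and conductance function $\mathfrak c:E\to(0,\infty)$. Write $x\sim y$ if $x$ and $y$ are joined by an edge, in which case $\mathfrak c(x,y)=\mathfrak c(y,x)$ is its conductance. Vertices may have infinite degree. The Dirichlet energy of $f:V\to\mathbb R$ is $\operatorname{Energy}(f)=\sum_{\{x,y\}\in E}\mathfrak c(x,y)|f(y)-f(x)|^2\in[0,\infty]$. A function $h:V\to\mathbb R$ is discrete harmonic at $x$ if $\sum_{y\sim x}\mathfrak c(x,y)|h(y)-h(x)|<\infty$ and $\sum_{y\sim x}\mathfrak c(x,y)(h(y)-h(x))=0$. *)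

theory Defs
  imports "HOL-Analysis.Analysis"
begin

text \<open>Edges are two-element subsets of the vertex set. The conductance \<open>c\<close> is only
  constrained on the edge set. Functions on a set \<open>S\<close> are elements of
  \<open>S \<rightarrow>\<^sub>E UNIV\<close>, so that equality of such functions is equality on \<open>S\<close>.\<close>

definition conductance_graph :: "'v set \<Rightarrow> 'v set set \<Rightarrow> ('v set \<Rightarrow> real) \<Rightarrow> bool" where
  "conductance_graph V E c \<longleftrightarrow>
     (\<forall>e\<in>E. \<exists>x\<in>V. \<exists>y\<in>V. x \<noteq> y \<and> e = {x, y}) \<and> (\<forall>e\<in>E. c e > 0)"

definition neighbours :: "'v set set \<Rightarrow> 'v \<Rightarrow> 'v set" where
  "neighbours E x = {y. {x, y} \<in> E}"

definition graph_connected :: "'v set \<Rightarrow> 'v set set \<Rightarrow> bool" where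
  "graph_connected V E \<longleftrightarrow> (\<forall>x\<in>V. \<forall>y\<in>V. (x, y) \<in> {(u, v). {u, v} \<in> E}\<^sup>*)"

definition edge_diff :: "('v \<Rightarrow> real) \<Rightarrow> 'v set \<Rightarrow> real" where
  "edge_diff f e = (THE d. \<exists>x y. e = {x, y} \<and> d = \<bar>f y - f x\<bar>)"

lemma edge_diff_pair: "edge_diff f {x, y} = \<bar>f y - f x\<bar>"
  unfolding edge_diff_def by (rule the_equality) (auto simp: doubleton_eq_iff)

definition dirichlet_energy :: "'v set set \<Rightarrow> ('v set \<Rightarrow> real) \<Rightarrow> ('v \<Rightarrow> real) \<Rightarrow> ennreal" where
  "dirichlet_energy E c f = (\<Sum>\<^sub>\<infinity>e\<in>E. ennreal (c e * (edge_diff f e)\<^sup>2))"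

definition discrete_harmonic_at ::
    "'v set set \<Rightarrow> ('v set \<Rightarrow> real) \<Rightarrow> ('v \<Rightarrow> real) \<Rightarrow> 'v \<Rightarrow> bool" where
  "discrete_harmonic_at E c h x \<longleftrightarrow>
     (\<lambda>y. c {x, y} * \<bar>h y - h x\<bar>) summable_on neighbours E x \<and>
     (\<Sum>\<^sub>\<infinity>y\<in>neighbours E x. c {x, y} * (h y - h x)) = 0"

definition energy_minimizing_extension ::
    "'v set \<Rightarrow> 'v set set \<Rightarrow> ('v set \<Rightarrow> real) \<Rightarrow> 'v set \<Rightarrow> ('v \<Rightarrow> real) \<Rightarrow> ('v \<Rightarrow> real) \<Rightarrow> bool" where
  "energy_minimizing_extension V E c A \<phi> h \<longleftrightarrow>
     h \<in> V \<rightarrow>\<^sub>E UNIV \<and> restrict h A = \<phi> \<and>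
     (\<forall>f \<in> V \<rightarrow>\<^sub>E UNIV. restrict f A = \<phi> \<longrightarrow> dirichlet_energy E c h \<le> dirichlet_energy E c f)"

text \<open>The function \<open>h\<^sup>\<phi>\<close>; meaningful only where the minimizer exists and is unique.\<close>

definition min_extension ::
    "'v set \<Rightarrow> 'v set set \<Rightarrow> ('v set \<Rightarrow> real) \<Rightarrow> 'v set \<Rightarrow> ('v \<Rightarrow> real) \<Rightarrow> ('v \<Rightarrow> real)" where
  "min_extension V E c A \<phi> = (THE h. energy_minimizing_extension V E c A \<phi> h)"

end

theory Submission imports Defs begin

text \<open>Functions of finite energy carry the Dirichlet form, a positive semidefinite bilinear form
  whose null space on a connected graph consists of the constants. Minimality of \<open>h\<close> is
  equivalent to orthogonality of \<open>h\<close> to every finite-energy function vanishing on \<open>A\<close>.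
  This condition is linear in \<open>h\<close>, so it gives uniqueness and linearity; tested on the
  indicator of a vertex outside \<open>A\<close>, which has finite energy because \<open>\<pi> < \<infinity>\<close>, it is
  harmonicity at that vertex. For existence, the parallelogram law makes a minimizing sequence
  Cauchy in energy, hence pointwise Cauchy along paths from \<open>A\<close>, and the energy is lower
  semicontinuous under pointwise convergence.\<close>

text \<open>Differences along an arbitrarily chosen orientation of the edges depend linearly on \<open>f\<close>,
  unlike the absolute value \<open>edge_diff\<close>; products of two such differences do not depend on
  the orientation.\<close>

definition orientation :: "'v set \<Rightarrow> 'v \<times> 'v" where
  "orientation e = (SOME p. e = {fst p, snd p})"

definition gradient :: "('v \<Rightarrow> real) \<Rightarrow> 'v set \<Rightarrow> real" where
  "gradient f e = f (snd (orientation e)) - f (fst (orientation e))"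

definition finite_energy :: "'v set set \<Rightarrow> ('v set \<Rightarrow> real) \<Rightarrow> ('v \<Rightarrow> real) \<Rightarrow> bool" where
  "finite_energy E c f \<longleftrightarrow> (\<lambda>e. c e * (gradient f e)\<^sup>2) summable_on E"

text \<open>\<open>infsum\<close> is 0 on a family that is not summable, so the value is meaningful
  only when the products are summable, as they are for two arguments of finite energy. This is why
  additivity below carries finite-energy hypotheses while scaling does not.\<close>

definition dirichlet_form :: "'v set set \<Rightarrow> ('v set \<Rightarrow> real) \<Rightarrow> ('v \<Rightarrow> real) \<Rightarrow> ('v \<Rightarrow> real) \<Rightarrow> real" where
  "dirichlet_form E c f g = (\<Sum>\<^sub>\<infinity>e\<in>E. c e * (gradient f e * gradient g e))"

lemma orientation_pair: "orientation {x, y} = (x, y) \<or> orientation {x, y} = (y, x)"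
proof -
  have "\<exists>p. {x, y} = {fst p, snd p}" by (rule exI[of _ "(x, y)"]) simp
  then have "{x, y} = {fst (orientation {x, y}), snd (orientation {x, y})}"
    unfolding orientation_def by (rule someI_ex)
  then show ?thesis by (metis doubleton_eq_iff prod.collapse)
qed

lemma gradient_mult_pair: "gradient f {x, y} * gradient g {x, y} = (f y - f x) * (g y - g x)"
  using orientation_pair[of x y] by (auto simp: gradient_def algebra_simps)

lemma gradient_power2_pair: "(gradient f {x, y})\<^sup>2 = (f y - f x)\<^sup>2"
  using gradient_mult_pair[of f x y f] by (simp add: power2_eq_square)

lemma gradient_linear:
  "gradient (\<lambda>x. f x + g x) e = gradient f e + gradient g e"
  "gradient (\<lambda>x. r * f x) e = r * gradient f e"
  by (simp_all add: gradient_def algebra_simps)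

section \<open>Networks and the vector space of finite-energy functions\<close>

locale conductance_network =
  fixes V :: "'v set" and E :: "'v set set" and c :: "'v set \<Rightarrow> real"
  assumes graph: "conductance_graph V E c"
    and connected: "graph_connected V E"
    and summable_conductance: "x \<in> V \<Longrightarrow> (\<lambda>y. c {x, y}) summable_on neighbours E x"
begin

abbreviation "fin_energy \<equiv> finite_energy E c"
abbreviation "form \<equiv> dirichlet_form E c"

lemma conductance_pos: "e \<in> E \<Longrightarrow> 0 < c e"
  using graph by (auto simp: conductance_graph_def)

lemma edge_cases:
  assumes "e \<in> E"
  obtains x y where "e = {x, y}" "x \<in> V" "y \<in> V" "x \<noteq> y"
  using assms graph by (auto simp: conductance_graph_def)

lemma edge_in_V: "{x, y} \<in> E \<Longrightarrow> x \<in> V \<and> y \<in> V \<and> x \<noteq> y"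
  by (erule edge_cases) (auto simp: doubleton_eq_iff)

lemma summand_nonneg: "e \<in> E \<Longrightarrow> 0 \<le> c e * (gradient f e)\<^sup>2"
  using conductance_pos[of e] by simp

text \<open>Both endpoints of an edge lie in \<open>V\<close>, so values off \<open>V\<close> never
  enter. This allows computing with total functions and passing to \<open>restrict f V\<close> only
  at the end.\<close>

lemma gradient_cong:
  assumes "e \<in> E" "\<And>x. x \<in> V \<Longrightarrow> f x = g x"
  shows "gradient f e = gradient g e"
proof -
  obtain x y where "e = {x, y}" "x \<in> V" "y \<in> V" using assms(1) by (blast elim: edge_cases)
  then show ?thesis using orientation_pair[of x y] assms(2) by (auto simp: gradient_def)
qed

lemma finite_energy_cong:
  assumes "\<And>x. x \<in> V \<Longrightarrow> f x = g x"
  shows "fin_energy f \<longleftrightarrow> fin_energy g"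
  unfolding finite_energy_def
  by (rule summable_on_cong) (simp add: gradient_cong[OF _ assms])

lemma form_cong:
  assumes "\<And>x. x \<in> V \<Longrightarrow> f x = f' x" "\<And>x. x \<in> V \<Longrightarrow> g x = g' x"
  shows "form f g = form f' g'"
  unfolding dirichlet_form_def
  by (rule infsum_cong) (simp add: gradient_cong[OF _ assms(1)] gradient_cong[OF _ assms(2)])

text \<open>Comparison with the sum of the two energy densities, by |uv| \<le> u^2 + v^2.\<close>

lemma summable_product:
  assumes "fin_energy f" "fin_energy g"
  shows "(\<lambda>e. c e * (gradient f e * gradient g e)) summable_on E"
proof -
  have "(\<lambda>e. c e * (gradient f e)\<^sup>2 + c e * (gradient g e)\<^sup>2) summable_on E"
    using assms unfolding finite_energy_def by (rule summable_on_add)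
  moreover have "norm (c e * (gradient f e * gradient g e))
      \<le> c e * (gradient f e)\<^sup>2 + c e * (gradient g e)\<^sup>2" if "e \<in> E" for e
  proof -
    have "\<bar>u * v\<bar> \<le> u\<^sup>2 + v\<^sup>2" for u v :: real
      using sum_squares_bound[of u v] sum_squares_bound[of u "-v"]
      by (simp add: abs_le_iff)
    then show ?thesis
      using conductance_pos[OF that]
      by (simp add: abs_mult flip: distrib_left)
  qed
  ultimately show ?thesis
    by (rule abs_summable_summable[OF Infinite_Sum.abs_summable_on_comparison_test'])
qed

lemma finite_energy_scale: "fin_energy f \<Longrightarrow> fin_energy (\<lambda>x. r * f x)"
  unfolding finite_energy_def gradient_linear power_mult_distrib mult.left_commute[of "c _"]
  by (rule summable_on_cmult_right)

lemma finite_energy_add: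
  assumes "fin_energy f" "fin_energy g"
  shows "fin_energy (\<lambda>x. f x + g x)"
proof -
  have "(\<lambda>e. (c e * (gradient f e)\<^sup>2 + c e * (gradient g e)\<^sup>2)
      + 2 * (c e * (gradient f e * gradient g e))) summable_on E"
    using assms summable_product[OF assms] unfolding finite_energy_def
    by (intro summable_on_add summable_on_cmult_right)
  then show ?thesis
    unfolding finite_energy_def gradient_linear
    by (rule back_subst[of "\<lambda>f. f summable_on E"])
      (simp add: fun_eq_iff power2_eq_square algebra_simps)
qed

lemma finite_energy_diff:
  "fin_energy f \<Longrightarrow> fin_energy g \<Longrightarrow> fin_energy (\<lambda>x. f x - g x)"
  using finite_energy_add[of f "\<lambda>x. -1 * g x"] finite_energy_scale[of g "-1"] by simp

section \<open>The Dirichlet form as a positive semidefinite bilinear form\<close>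

lemma form_commute: "form f g = form g f"
  by (simp add: dirichlet_form_def mult.commute)

lemma form_nonneg: "0 \<le> form f f"
  unfolding dirichlet_form_def
  by (rule infsum_nonneg) (use conductance_pos in \<open>simp add: less_imp_le\<close>)

lemma form_scale_left: "form (\<lambda>x. r * f x) g = r * form f g"
  unfolding dirichlet_form_def gradient_linear
  by (subst infsum_cmult_right'[symmetric]) (simp add: mult_ac)

lemma form_add_left:
  assumes "fin_energy f" "fin_energy g" "fin_energy k"
  shows "form (\<lambda>x. f x + g x) k = form f k + form g k"
  unfolding dirichlet_form_def gradient_linear distrib_right distrib_left
  by (rule infsum_add) (use assms summable_product in auto)

lemma form_diff_left:
  assumes "fin_energy f" "fin_energy g" "fin_energy k"
  shows "form (\<lambda>x. f x - g x) k = form f k - form g k"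
  using form_add_left[of f "\<lambda>x. -1 * g x" k] form_scale_left[of "-1" g k]
    finite_energy_scale[of g "-1"] assms by simp

text \<open>The energy along a line is a quadratic polynomial in \<open>t\<close>. General
  \<open>t\<close> serves the variational argument, \<open>t = 1\<close> the Pythagorean identity,
  and \<open>t = 1\<close> with \<open>t = -1\<close> the parallelogram law.\<close>

lemma form_add_scaled:
  assumes "fin_energy f" "fin_energy g"
  shows "form (\<lambda>x. f x + t * g x) (\<lambda>x. f x + t * g x) = form f f + 2 * t * form f g + t\<^sup>2 * form g g"
proof -
  let ?g = "\<lambda>x. t * g x"
  have g: "fin_energy ?g" using assms(2) by (rule finite_energy_scale)
  have right: "form k (\<lambda>x. f x + ?g x) = form k f + t * form k g" if "fin_energy k" for k
    using form_add_left[OF assms(1) g that] form_scale_left[of t g k]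
    by (simp add: form_commute[of k])
  show ?thesis
    by (simp add: form_add_left[OF assms(1) g finite_energy_add[OF assms(1) g]] form_scale_left
        right assms form_commute[of g f] power2_eq_square algebra_simps)
qed

lemma form_parallelogram:
  assumes "fin_energy f" "fin_energy g"
  shows "form (\<lambda>x. f x - g x) (\<lambda>x. f x - g x) + form (\<lambda>x. f x + g x) (\<lambda>x. f x + g x)
    = 2 * form f f + 2 * form g g"
  using form_add_scaled[OF assms, of 1] form_add_scaled[OF assms, of "-1"] by simp

text \<open>Bridge between the extended-valued energy and the real form. Both are suprema of finite
  partial sums; if the energy were finite without summability, it would bound these partial sums,
  and bounded partial sums of nonnegative terms force summability.\<close>

lemma dirichlet_energy_eq:
  "dirichlet_energy E c f = (if fin_energy f then ennreal (form f f) else \<infinity>)"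
proof -
  let ?q = "\<lambda>e. c e * (gradient f e)\<^sup>2"
  have edge: "ennreal (c e * (edge_diff f e)\<^sup>2) = ennreal (?q e)" if "e \<in> E" for e
    using that by (elim edge_cases) (simp add: edge_diff_pair gradient_power2_pair)
  have "dirichlet_energy E c f = (\<Sum>\<^sub>\<infinity>e\<in>E. ennreal (?q e))"
    unfolding dirichlet_energy_def by (rule infsum_cong) (rule edge)
  also have "\<dots> = (SUP F\<in>{F. finite F \<and> F \<subseteq> E}. \<Sum>e\<in>F. ennreal (?q e))"
    by (rule nonneg_infsum_complete) simp
  also have "\<dots> = (SUP F\<in>{F. finite F \<and> F \<subseteq> E}. ennreal (sum ?q F))"
    by (rule SUP_cong) (auto intro!: sum_ennreal summand_nonneg)
  finally have energy: "dirichlet_energy E c f = (SUP F\<in>{F. finite F \<and> F \<subseteq> E}. ennreal (sum ?q F))" .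
  show ?thesis
  proof (cases "fin_energy f")
    case True
    then have "ennreal (infsum ?q E) = (SUP F\<in>{F. finite F \<and> F \<subseteq> E}. ennreal (sum ?q F))"
      unfolding finite_energy_def
      by (rule infsum_nonneg_is_SUPREMUM_ennreal) (rule summand_nonneg)
    then show ?thesis using True energy by (simp add: dirichlet_form_def power2_eq_square)
  next
    case False
    have "dirichlet_energy E c f = \<infinity>"
    proof (rule ccontr)
      assume "dirichlet_energy E c f \<noteq> \<infinity>"
      then obtain b where b: "b \<ge> 0" "dirichlet_energy E c f = ennreal b"
        by (cases "dirichlet_energy E c f") auto
      have "sum ?q F \<le> b" if "finite F" "F \<subseteq> E" for F
      proof -
        have "ennreal (sum ?q F) \<le> dirichlet_energy E c f"
          unfolding energy by (rule SUP_upper) (use that in auto)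
        then show ?thesis using b by simp
      qed
      then have "bdd_above (sum ?q ` {F. F \<subseteq> E \<and> finite F})"
        by (intro bdd_aboveI2[where M = b]) auto
      then have "?q summable_on E"
        by (intro nonneg_bdd_above_summable_on) (auto intro: summand_nonneg)
      then show False using False by (simp add: finite_energy_def)
    qed
    then show ?thesis using False by simp
  qed
qed

text \<open>A vanishing sum of nonnegative terms has only zero terms. As conductances are positive,
  \<open>f\<close> agrees across every edge, hence along every path.\<close>

lemma form_0_imp_const:
  assumes "fin_energy f" "form f f = 0" "x \<in> V" "y \<in> V"
  shows "f x = f y"
proof -
  have step: "f u = f v" if "{u, v} \<in> E" for u v
  proof -
    have "c {u, v} * (gradient f {u, v})\<^sup>2 = 0"
      by (rule nonneg_infsum_le_0D[OF _ _ summand_nonneg that])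
        (use assms in \<open>simp_all add: finite_energy_def dirichlet_form_def power2_eq_square\<close>)
    then show ?thesis using conductance_pos[OF that] by (simp add: gradient_power2_pair)
  qed
  have "(x, y) \<in> {(u, v). {u, v} \<in> E}\<^sup>*"
    using connected assms by (auto simp: graph_connected_def)
  then show ?thesis by induction (use step in auto)
qed

section \<open>Vertex indicators and harmonicity\<close>

lemma incident_edge:
  assumes "e \<in> E" "x \<in> e"
  obtains y where "e = {x, y}" "y \<noteq> x" "y \<in> neighbours E x"
proof -
  obtain u v where "e = {u, v}" "u \<noteq> v" using assms(1) by (blast elim: edge_cases)
  then have "e = {x, u} \<and> u \<noteq> x \<or> e = {x, v} \<and> v \<noteq> x" using assms(2) by auto
  then show thesis using that assms(1) by (auto simp: neighbours_def)
qed

text \<open>Translates between sums over neighbours, used for \<pi> and harmonicity, and sums over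
  edges, used for the energy.\<close>

lemma bij_betw_neighbours: "bij_betw (\<lambda>y. {x, y}) (neighbours E x) {e \<in> E. x \<in> e}"
proof (rule bij_betwI')
  fix e assume "e \<in> {e \<in> E. x \<in> e}"
  then show "\<exists>y\<in>neighbours E x. e = {x, y}"
    by (blast elim: incident_edge)
qed (auto simp: neighbours_def doubleton_eq_iff)

lemma gradient_indicator_eq_0:
  assumes "e \<in> E" "x \<notin> e"
  shows "gradient (indicator {x}) e = 0"
proof -
  obtain u v where "e = {u, v}" using assms(1) by (blast elim: edge_cases)
  then show ?thesis
    using orientation_pair[of u v] assms(2) by (auto simp: gradient_def indicator_def)
qed

text \<open>The squared gradient is 1 on edges at \<open>x\<close> and 0 elsewhere, so the energy of
  the indicator is \<pi>(x).\<close>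

lemma finite_energy_indicator:
  assumes "x \<in> V"
  shows "fin_energy (indicator {x})"
proof -
  have "c summable_on {e \<in> E. x \<in> e}"
    using summable_conductance[OF assms]
    by (simp add: summable_on_reindex_bij_betw[OF bij_betw_neighbours])
  moreover have "c summable_on {e \<in> E. x \<in> e} \<longleftrightarrow>
      (\<lambda>e. c e * (gradient (indicator {x}) e)\<^sup>2) summable_on E"
  proof (rule summable_on_cong_neutral)
    fix e assume "e \<in> E - {e \<in> E. x \<in> e}"
    then show "c e * (gradient (indicator {x}) e)\<^sup>2 = 0"
      by (simp add: gradient_indicator_eq_0)
  next
    fix e assume "e \<in> {e \<in> E. x \<in> e} \<inter> E"
    then obtain y where "e = {x, y}" "y \<noteq> x"
      by (blast elim: incident_edge)
    then show "c e = c e * (gradient (indicator {x}) e)\<^sup>2"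
      by (simp add: gradient_power2_pair)
  qed auto
  ultimately show ?thesis by (simp add: finite_energy_def)
qed

lemma finite_energy_finite_support:
  assumes "finite S" "S \<subseteq> V"
  shows "fin_energy (\<lambda>x. \<Sum>s\<in>S. f s * indicator {s} x)"
  using assms
proof (induction S)
  case empty
  then show ?case by (simp add: finite_energy_def gradient_def)
next
  case (insert s S)
  then show ?case
    unfolding sum.insert[OF insert.hyps]
    by (intro finite_energy_add[of "\<lambda>x. f s * indicator {s} x"] finite_energy_scale
        finite_energy_indicator) auto
qed

text \<open>Only edges at \<open>x\<close> contribute to the pairing with the indicator, which is
  therefore minus the sum in the harmonicity condition. Absolute summability holds because unordered
  summability of reals is absolute.\<close>

lemma harmonic_if_orthogonal:
  assumes "x \<in> V" "fin_energy h" "form h (indicator {x}) = 0"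
  shows "discrete_harmonic_at E c h x"
proof -
  let ?p = "\<lambda>e. c e * (gradient h e * gradient (indicator {x}) e)"
  let ?S = "{e \<in> E. x \<in> e}"
  have zero: "?p e = 0" if "e \<in> E" "x \<notin> e" for e
    using that by (simp add: gradient_indicator_eq_0)
  \<comment> \<open>Read from \<open>x\<close> to \<open>y\<close>, the indicator drops from 1 to 0;
    hence the minus sign.\<close>
  have edge: "?p {x, y} = - (c {x, y} * (h y - h x))" if "y \<in> neighbours E x" for y
    using that edge_in_V[of x y] by (auto simp: neighbours_def gradient_mult_pair algebra_simps)
  have "?p summable_on ?S \<longleftrightarrow> ?p summable_on E"
    by (rule summable_on_cong_neutral) (use zero in auto)
  then have "(\<lambda>y. ?p {x, y}) summable_on neighbours E x"
    using summable_product[OF assms(2) finite_energy_indicator[OF assms(1)]]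
    by (simp add: summable_on_reindex_bij_betw[OF bij_betw_neighbours, of ?p])
  then have "(\<lambda>y. \<bar>?p {x, y}\<bar>) summable_on neighbours E x"
    by (rule summable_on_iff_abs_summable_on_real[THEN iffD1, unfolded real_norm_def])
  moreover have "\<bar>?p {x, y}\<bar> = c {x, y} * \<bar>h y - h x\<bar>" if "y \<in> neighbours E x" for y
    using edge[OF that] that conductance_pos[of "{x, y}"] by (simp add: abs_mult neighbours_def)
  ultimately have "(\<lambda>y. c {x, y} * \<bar>h y - h x\<bar>) summable_on neighbours E x"
    by (simp cong: summable_on_cong)
  moreover have "(\<Sum>\<^sub>\<infinity>y\<in>neighbours E x. c {x, y} * (h y - h x)) = 0"
  proof -
    have "0 = infsum ?p E" using assms(3) by (simp add: dirichlet_form_def)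
    also have "\<dots> = infsum ?p ?S" by (rule infsum_cong_neutral) (use zero in auto)
    also have "\<dots> = (\<Sum>\<^sub>\<infinity>y\<in>neighbours E x. ?p {x, y})"
      by (rule infsum_reindex_bij_betw[OF bij_betw_neighbours, symmetric])
    also have "\<dots> = (\<Sum>\<^sub>\<infinity>y\<in>neighbours E x. - (c {x, y} * (h y - h x)))"
      by (rule infsum_cong) (rule edge)
    finally show ?thesis by (simp add: infsum_uminus)
  qed
  ultimately show ?thesis by (simp add: discrete_harmonic_at_def)
qed

section \<open>Minimality as orthogonality, and uniqueness\<close>

text \<open>The weak (Euler-Lagrange) form of the problem. Test functions range over all
  finite-energy functions vanishing on \<open>A\<close>; indicators alone would give only pointwise
  harmonicity, which in general does not determine \<open>h\<close>.\<close>

definition harmonic_extension :: "'v set \<Rightarrow> ('v \<Rightarrow> real) \<Rightarrow> ('v \<Rightarrow> real) \<Rightarrow> bool" where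
  "harmonic_extension A \<phi> h \<longleftrightarrow> h \<in> V \<rightarrow>\<^sub>E UNIV \<and> restrict h A = \<phi> \<and> fin_energy h \<and>
     (\<forall>g. fin_energy g \<longrightarrow> (\<forall>a\<in>A. g a = 0) \<longrightarrow> form h g = 0)"

text \<open>Extending \<phi> by zero gives a finite combination of vertex indicators. It shows that
  the minimization is over a class containing a function of finite energy.\<close>

lemma finite_energy_extension:
  assumes "finite A" "A \<subseteq> V" "\<phi> \<in> A \<rightarrow>\<^sub>E UNIV"
  obtains f where "f \<in> V \<rightarrow>\<^sub>E UNIV" "restrict f A = \<phi>" "fin_energy f"
proof
  let ?f = "\<lambda>x. \<Sum>s\<in>A. \<phi> s * indicator {s} x"
  show "restrict ?f V \<in> V \<rightarrow>\<^sub>E UNIV" by simp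
  show "fin_energy (restrict ?f V)"
    using finite_energy_finite_support[OF assms(1,2)]
    by (subst finite_energy_cong[where g = ?f]) auto
  have "?f a = \<phi> a" if "a \<in> A" for a
  proof -
    have "?f a = (\<Sum>s\<in>A. if s = a then \<phi> s else 0)"
      by (rule sum.cong) (auto simp: indicator_def)
    then show ?thesis using that assms(1) by simp
  qed
  then show "restrict (restrict ?f V) A = \<phi>"
    using assms by (auto simp: fun_eq_iff restrict_def PiE_def extensional_def subset_iff)
qed

text \<open>Forwards, \<open>h + t g\<close> is a competitor for every \<open>t\<close> when
  \<open>g\<close> vanishes on \<open>A\<close>, so the linear term in \<open>t\<close> must vanish.
  Backwards, a competitor \<open>f\<close> of finite energy differs from \<open>h\<close> by a test
  function, and its energy is that of \<open>h\<close> plus that of \<open>f - h\<close>.\<close>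

lemma minimizing_iff_harmonic_extension:
  assumes "finite A" "A \<subseteq> V" "\<phi> \<in> A \<rightarrow>\<^sub>E UNIV"
  shows "energy_minimizing_extension V E c A \<phi> h \<longleftrightarrow> harmonic_extension A \<phi> h"
proof
  assume min: "energy_minimizing_extension V E c A \<phi> h"
  have h: "h \<in> V \<rightarrow>\<^sub>E UNIV" "restrict h A = \<phi>"
    and le: "\<And>f. f \<in> V \<rightarrow>\<^sub>E UNIV \<Longrightarrow> restrict f A = \<phi> \<Longrightarrow>
      dirichlet_energy E c h \<le> dirichlet_energy E c f"
    using min by (auto simp: energy_minimizing_extension_def)
  obtain f where "f \<in> V \<rightarrow>\<^sub>E UNIV" "restrict f A = \<phi>" "fin_energy f"
    using finite_energy_extension[OF assms] .
  then have fin: "fin_energy h"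
    using le[of f] by (auto simp: dirichlet_energy_eq top_unique split: if_splits)
  moreover have "form h g = 0" if g: "fin_energy g" "\<forall>a\<in>A. g a = 0" for g
  proof -
    have "0 \<le> 2 * t * form h g + t\<^sup>2 * form g g" for t
    proof -
      let ?k = "\<lambda>x. h x + t * g x"
      have k: "fin_energy ?k" using fin g by (intro finite_energy_add finite_energy_scale)
      have "dirichlet_energy E c h \<le> dirichlet_energy E c (restrict ?k V)"
      proof (rule le)
        show "restrict (restrict ?k V) A = \<phi>"
          unfolding h(2)[symmetric] using g(2) assms(2) by (auto simp: fun_eq_iff restrict_def)
      qed simp
      also have "\<dots> = ennreal (form ?k ?k)"
        using k finite_energy_cong[of "restrict ?k V" ?k]
          form_cong[of "restrict ?k V" ?k "restrict ?k V" ?k]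
        by (simp add: dirichlet_energy_eq)
      finally have "form h h \<le> form ?k ?k" using fin form_nonneg by (simp add: dirichlet_energy_eq)
      then show ?thesis using form_add_scaled[OF fin g(1), of t] by simp
    qed
    note quad = this
    \<comment> \<open>The parameter \<open>t = - form h g / s\<close> stays meaningful when \<open>form g g = 0\<close>.\<close>
    define s where "s = form g g + 1"
    have s: "s > 0" using form_nonneg[of g] by (simp add: s_def)
    have "0 \<le> s\<^sup>2 * (2 * (- form h g / s) * form h g + (- form h g / s)\<^sup>2 * form g g)"
      by (rule mult_nonneg_nonneg) (use quad[of "- form h g / s"] in simp_all)
    \<comment> \<open>Since \<open>form g g = s - 1\<close>, the product is
      \<open>- 2 * s + (s - 1) = - (s + 1)\<close> times the square of \<open>form h g\<close>;
      being nonnegative, it forces \<open>form h g = 0\<close>.\<close>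
    also have "\<dots> = - (form h g)\<^sup>2 * (s + 1)"
      using s by (simp add: field_simps power2_eq_square) (simp add: s_def algebra_simps)
    finally have "(form h g)\<^sup>2 * (s + 1) \<le> 0" by simp
    then show ?thesis using s by (simp add: mult_le_0_iff)
  qed
  ultimately show "harmonic_extension A \<phi> h" using h by (simp add: harmonic_extension_def)
next
  assume harm: "harmonic_extension A \<phi> h"
  have "dirichlet_energy E c h \<le> dirichlet_energy E c f"
    if f: "f \<in> V \<rightarrow>\<^sub>E UNIV" "restrict f A = \<phi>" for f
  proof (cases "fin_energy f")
    case True
    let ?g = "\<lambda>x. f x - h x"
    have h: "fin_energy h" "restrict h A = \<phi>" using harm by (auto simp: harmonic_extension_def)
    have g: "fin_energy ?g" using True h by (intro finite_energy_diff)
    have "f a = h a" if "a \<in> A" for a using f(2) h(2) that by (metis restrict_apply')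
    then have "form h ?g = 0" using harm g by (simp add: harmonic_extension_def)
    then have "form f f = form h h + form ?g ?g"
      using form_add_scaled[OF h(1) g, of 1] by simp
    then show ?thesis
      using True h form_nonneg[of ?g] by (simp add: dirichlet_energy_eq ennreal_leI)
  qed (simp add: dirichlet_energy_eq)
  then show "energy_minimizing_extension V E c A \<phi> h"
    using harm by (simp add: harmonic_extension_def energy_minimizing_extension_def)
qed

text \<open>The difference of two solutions vanishes on \<open>A\<close>, so it is itself a test
  function and is orthogonal to itself. It is then constant on \<open>V\<close>, and a point of
  \<open>A\<close> makes the constant 0.\<close>

lemma harmonic_extension_unique:
  assumes "A \<subseteq> V" "A \<noteq> {}" "harmonic_extension A \<phi> h" "harmonic_extension A \<phi> k"
  shows "h = k"
proof -
  let ?g = "\<lambda>x. h x - k x"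
  have fin: "fin_energy h" "fin_energy k" using assms by (auto simp: harmonic_extension_def)
  then have g: "fin_energy ?g" by (rule finite_energy_diff)
  have on_A: "?g a = 0" if "a \<in> A" for a
    using assms(3,4) that unfolding harmonic_extension_def by (metis restrict_apply' diff_self)
  have "form h ?g = 0" "form k ?g = 0"
    using assms(3,4) g on_A by (auto simp: harmonic_extension_def)
  then have "form ?g ?g = 0" using form_diff_left[OF fin g] by simp
  moreover obtain a where "a \<in> A" using assms(2) by blast
  ultimately have "h x = k x" if "x \<in> V" for x
    using form_0_imp_const[OF g _ that, of a] on_A[of a] assms(1) by auto
  then show ?thesis
    using assms(3,4) by (intro PiE_ext[of h V _ k]) (auto simp: harmonic_extension_def)
qed

section \<open>Existence of a minimizer\<close>

text \<open>A Fatou argument: each finite partial sum converges along the sequence and is dominated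
  by the full energies, so its limit is at most \<open>m\<close>.\<close>

lemma energy_lower_semicontinuous:
  assumes fin: "\<And>n. fin_energy (F n)"
    and lim: "\<And>x. x \<in> V \<Longrightarrow> (\<lambda>n. F n x) \<longlonglongrightarrow> h x"
    and energy: "(\<lambda>n. form (F n) (F n)) \<longlonglongrightarrow> m"
  shows "fin_energy h" "form h h \<le> m"
proof -
  let ?q = "\<lambda>f e. c e * (gradient f e)\<^sup>2"
  have bound: "sum (?q h) S \<le> m" if S: "finite S" "S \<subseteq> E" for S
  proof (rule LIMSEQ_le)
    have "(\<lambda>n. ?q (F n) e) \<longlonglongrightarrow> ?q h e" if edge: "e \<in> E" for e
    proof -
      obtain x y where e: "e = {x, y}" "x \<in> V" "y \<in> V" using edge by (blast elim: edge_cases)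
      show ?thesis unfolding e gradient_power2_pair by (intro tendsto_intros lim e)
    qed
    then show "(\<lambda>n. sum (?q (F n)) S) \<longlonglongrightarrow> sum (?q h) S"
      using S by (intro tendsto_sum) auto
    have "sum (?q (F n)) S \<le> form (F n) (F n)" for n
      unfolding dirichlet_form_def power2_eq_square[symmetric]
      using fin[of n] S unfolding finite_energy_def
      by (intro finite_sum_le_infsum) (auto intro: summand_nonneg)
    then show "\<exists>N. \<forall>n\<ge>N. sum (?q (F n)) S \<le> form (F n) (F n)" by blast
  qed (rule energy)
  then have "bdd_above (sum (?q h) ` {S. S \<subseteq> E \<and> finite S})"
    by (intro bdd_aboveI2[where M = m]) auto
  then have sum: "?q h summable_on E"
    by (intro nonneg_bdd_above_summable_on) (auto intro: summand_nonneg)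
  then show "fin_energy h" by (simp add: finite_energy_def)
  show "form h h \<le> m"
    unfolding dirichlet_form_def power2_eq_square[symmetric]
    using sum bound by (rule infsum_le_finite_sums)
qed

text \<open>The energy of a difference dominates its term at any single edge, so the increments of
  \<open>F n\<close> across an edge are Cauchy. Convergence then spreads from \<open>a\<close> along
  a path, one edge at a time.\<close>

lemma pointwise_convergent:
  assumes fin: "\<And>n. fin_energy (F n)"
    and Cauchy: "\<And>\<epsilon>. \<epsilon> > 0 \<Longrightarrow> \<exists>N. \<forall>n\<ge>N. \<forall>k\<ge>N.
      form (\<lambda>x. F n x - F k x) (\<lambda>x. F n x - F k x) < \<epsilon>"
    and a: "a \<in> V" "convergent (\<lambda>n. F n a)" and x: "x \<in> V"
  shows "convergent (\<lambda>n. F n x)"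
proof -
  have "(a, x) \<in> {(u, v). {u, v} \<in> E}\<^sup>*"
    using connected a x by (auto simp: graph_connected_def)
  then show ?thesis
  proof induction
    case base
    then show ?case using a by simp
  next
    case (step u v)
    then have e: "{u, v} \<in> E" by simp
    have "Cauchy (\<lambda>n. F n v - F n u)"
    proof (rule metric_CauchyI)
      fix \<epsilon> :: real assume \<epsilon>: "\<epsilon> > 0"
      \<comment> \<open>The threshold is the energy of a single edge \<open>{u, v}\<close> with
        increment \<epsilon>.\<close>
      then obtain N where N: "\<And>n k. n \<ge> N \<Longrightarrow> k \<ge> N \<Longrightarrow>
          form (\<lambda>x. F n x - F k x) (\<lambda>x. F n x - F k x) < c {u, v} * \<epsilon>\<^sup>2"
        using Cauchy[of "c {u, v} * \<epsilon>\<^sup>2"] conductance_pos[OF e] by auto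
      have "dist (F n v - F n u) (F k v - F k u) < \<epsilon>" if "n \<ge> N" "k \<ge> N" for n k
      proof -
        let ?d = "\<lambda>x. F n x - F k x"
        have "fin_energy ?d" using fin by (intro finite_energy_diff)
        then have "(\<Sum>e\<in>{{u, v}}. c e * (gradient ?d e)\<^sup>2) \<le> form ?d ?d"
          unfolding dirichlet_form_def power2_eq_square[symmetric] finite_energy_def
          using e by (intro finite_sum_le_infsum) (auto intro: summand_nonneg)
        then have "c {u, v} * (?d v - ?d u)\<^sup>2 < c {u, v} * \<epsilon>\<^sup>2"
          using N[OF that] by (simp add: gradient_power2_pair)
        then have "(?d v - ?d u)\<^sup>2 < \<epsilon>\<^sup>2" using conductance_pos[OF e] by simp
        then have "\<bar>?d v - ?d u\<bar> < \<epsilon>" 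
          using \<epsilon> by (intro power2_less_imp_less[of "\<bar>?d v - ?d u\<bar>"]) simp_all
        then show ?thesis by (simp add: dist_real_def algebra_simps)
      qed
      then show "\<exists>M. \<forall>m\<ge>M. \<forall>n\<ge>M. dist (F m v - F m u) (F n v - F n u) < \<epsilon>" by blast
    qed
    then have "convergent (\<lambda>n. (F n v - F n u) + F n u)"
      using step.IH by (intro convergent_add) (simp_all add: Cauchy_convergent_iff)
    then show ?case by simp
  qed
qed

lemma minimizing_extension_exists:
  assumes "finite A" "A \<subseteq> V" "A \<noteq> {}" "\<phi> \<in> A \<rightarrow>\<^sub>E UNIV"
  shows "\<exists>h. energy_minimizing_extension V E c A \<phi> h"
proof -
  \<comment> \<open>Members of \<open>K\<close> are total functions prescribed only on
    \<open>A\<close>, so midpoints stay in \<open>K\<close> without being restricted to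
    \<open>V\<close>.\<close>
  define K where "K = {f. fin_energy f \<and> (\<forall>a\<in>A. f a = \<phi> a)}"
  define m where "m = (INF f\<in>K. form f f)"
  obtain f0 where "restrict f0 A = \<phi>" "fin_energy f0"
    using finite_energy_extension[OF assms(1,2,4)] by metis
  then have "f0 \<in> K" by (auto simp: K_def)
  have bdd: "bdd_below ((\<lambda>f. form f f) ` K)"
    by (rule bdd_belowI2[where m = 0]) (rule form_nonneg)
  have m_le: "m \<le> form f f" if "f \<in> K" for f
    unfolding m_def using bdd that by (rule cINF_lower)
  have "\<exists>f\<in>K. form f f < m + 1 / real (Suc n)" for n
    using cINF_less_iff[OF _ bdd, of "m + 1 / real (Suc n)"] \<open>f0 \<in> K\<close> by (auto simp: m_def)
  then obtain F where F: "\<And>n. F n \<in> K" "\<And>n. form (F n) (F n) < m + 1 / real (Suc n)"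
    by metis
  have fin: "fin_energy (F n)" for n using F(1)[of n] by (simp add: K_def)
  have lim_m: "(\<lambda>n. form (F n) (F n)) \<longlonglongrightarrow> m"
  proof (rule tendsto_sandwich)
    show "\<forall>\<^sub>F n in sequentially. m \<le> form (F n) (F n)" using m_le F(1) by simp
    show "\<forall>\<^sub>F n in sequentially. form (F n) (F n) \<le> m + 1 / real (Suc n)"
      using F(2) by (simp add: less_imp_le)
    show "(\<lambda>n. m + 1 / real (Suc n)) \<longlonglongrightarrow> m"
      using tendsto_add[OF tendsto_const[of m] lim_1_over_n[THEN LIMSEQ_Suc]] by simp
  qed simp
  \<comment> \<open>The midpoint of \<open>F n\<close> and \<open>F k\<close> lies in
    \<open>K\<close>, so the energy of their sum is at least \<open>4 * m\<close>; the parallelogram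
    law turns this into an upper bound for the energy of their difference.\<close>
  have diff_le: "form (\<lambda>x. F n x - F k x) (\<lambda>x. F n x - F k x)
      \<le> 2 * (form (F n) (F n) - m) + 2 * (form (F k) (F k) - m)" for n k
  proof -
    let ?s = "\<lambda>x. F n x + F k x"
    let ?mid = "\<lambda>x. 1/2 * ?s x"
    have "?mid \<in> K"
      using F(1)[of n] F(1)[of k]
      by (auto simp: K_def intro!: finite_energy_scale[of ?s "1/2", simplified] finite_energy_add)
    then have "m \<le> form ?mid ?mid" by (rule m_le)
    also have "form ?mid ?mid = 1/4 * form ?s ?s"
      using form_scale_left[of "1/2" ?s ?mid] form_scale_left[of "1/2" ?s ?s]
        form_commute[of ?s ?mid]
      by simp
    finally show ?thesis using form_parallelogram[OF fin[of n] fin[of k]] by simp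
  qed
  have Cauchy: "\<exists>N. \<forall>n\<ge>N. \<forall>k\<ge>N. form (\<lambda>x. F n x - F k x) (\<lambda>x. F n x - F k x) < \<epsilon>"
    if \<epsilon>: "\<epsilon> > 0" for \<epsilon> :: real
  proof -
    obtain N where N: "\<And>n. n \<ge> N \<Longrightarrow> form (F n) (F n) < m + \<epsilon> / 4"
      using order_tendstoD(2)[OF lim_m, of "m + \<epsilon> / 4"] \<epsilon>
      by (auto simp: eventually_sequentially)
    have "form (\<lambda>x. F n x - F k x) (\<lambda>x. F n x - F k x) < \<epsilon>" if "n \<ge> N" "k \<ge> N" for n k
    proof (rule le_less_trans[OF diff_le])
      show "2 * (form (F n) (F n) - m) + 2 * (form (F k) (F k) - m) < \<epsilon>"
        using N[OF that(1)] N[OF that(2)] by (simp add: field_simps)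
    qed
    then show ?thesis by blast
  qed
  \<comment> \<open>On \<open>A\<close> the sequence is constantly \<phi>, which supplies the
    starting point for convergence along paths.\<close>
  obtain a where a: "a \<in> A" using assms(3) by blast
  have "convergent (\<lambda>n. F n a)"
    using F(1) a by (simp add: K_def convergent_const)
  then have "convergent (\<lambda>n. F n x)" if "x \<in> V" for x
    using pointwise_convergent[of F, OF fin Cauchy] a assms(2) that by blast
  define h where "h = restrict (\<lambda>x. lim (\<lambda>n. F n x)) V"
  have lim_h: "(\<lambda>n. F n x) \<longlonglongrightarrow> h x" if "x \<in> V" for x
    using \<open>\<And>x. x \<in> V \<Longrightarrow> convergent (\<lambda>n. F n x)\<close>[OF that] that
    by (simp add: h_def convergent_LIMSEQ_iff)
  \<comment> \<open>The energy of the limit is at most the infimum \<open>m\<close>, which makes it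
    minimal once its values on \<open>A\<close> are known to be \<phi>.\<close>
  note h = energy_lower_semicontinuous[of F h m, OF fin lim_h lim_m]
  have "h a = \<phi> a" if "a \<in> A" for a
  proof (rule LIMSEQ_unique)
    show "(\<lambda>n. F n a) \<longlonglongrightarrow> h a" using that assms(2) by (intro lim_h) auto
    show "(\<lambda>n. F n a) \<longlonglongrightarrow> \<phi> a" using F(1) that by (simp add: K_def)
  qed
  then have "restrict h A = \<phi>"
    using assms(4) by (auto simp: fun_eq_iff restrict_def PiE_def extensional_def)
  moreover have "dirichlet_energy E c h \<le> dirichlet_energy E c f"
    if "restrict f A = \<phi>" for f
  proof (cases "fin_energy f")
    case True
    then have "m \<le> form f f" using that by (intro m_le) (auto simp: K_def)
    then show ?thesis using True h by (simp add: dirichlet_energy_eq ennreal_leI)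
  qed (simp add: dirichlet_energy_eq)
  moreover have "h \<in> V \<rightarrow>\<^sub>E UNIV" by (simp add: h_def)
  ultimately show ?thesis by (auto simp: energy_minimizing_extension_def)
qed

section \<open>Linearity and conclusion\<close>

text \<open>Pointwise sums and multiples of functions extensional on \<open>V\<close> need not be
  extensional. Orthogonality can be checked for the unrestricted combination and is carried over
  here.\<close>

lemma harmonic_extension_restrict:
  assumes "A \<subseteq> V" "fin_energy f"
    and "\<And>g. fin_energy g \<Longrightarrow> \<forall>a\<in>A. g a = 0 \<Longrightarrow> form f g = 0"
  shows "harmonic_extension A (restrict f A) (restrict f V)"
proof -
  have "fin_energy (restrict f V)"
    using assms(2) finite_energy_cong[of "restrict f V" f] by simp
  moreover have "form (restrict f V) g = form f g" for g by (rule form_cong) auto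
  moreover have "restrict (restrict f V) A = restrict f A"
    using assms(1) by (simp add: Int_absorb1)
  ultimately show ?thesis using assms(3) by (simp add: harmonic_extension_def)
qed

end

theorem proposition1p3:
  fixes V :: "'v set" and E :: "'v set set" and c :: "'v set \<Rightarrow> real" and A :: "'v set"
  assumes "conductance_graph V E c"
    and "countable V" and "infinite V"
    and "graph_connected V E"
    and "\<And>x. x \<in> V \<Longrightarrow> (\<lambda>y. c {x, y}) summable_on neighbours E x"
    and "A \<subseteq> V" and "A \<noteq> {}" and "finite A"
  shows "(\<forall>\<phi> \<in> A \<rightarrow>\<^sub>E (UNIV :: real set).
            (\<exists>!h. energy_minimizing_extension V E c A \<phi> h) \<and>
            (\<forall>x \<in> V - A. discrete_harmonic_at E c (min_extension V E c A \<phi>) x) \<and>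
            dirichlet_energy E c (min_extension V E c A \<phi>) < \<infinity>) \<and>
         (\<forall>\<phi> \<in> A \<rightarrow>\<^sub>E (UNIV :: real set). \<forall>\<psi> \<in> A \<rightarrow>\<^sub>E (UNIV :: real set).
            min_extension V E c A (\<lambda>x\<in>A. \<phi> x + \<psi> x) =
              (\<lambda>x\<in>V. min_extension V E c A \<phi> x + min_extension V E c A \<psi> x)) \<and>
         (\<forall>r :: real. \<forall>\<phi> \<in> A \<rightarrow>\<^sub>E (UNIV :: real set).
            min_extension V E c A (\<lambda>x\<in>A. r * \<phi> x) =
              (\<lambda>x\<in>V. r * min_extension V E c A \<phi> x))"
proof -
  interpret conductance_network V E c
    using assms by unfold_locales
  note A = \<open>finite A\<close> \<open>A \<subseteq> V\<close>
  note min_iff = minimizing_iff_harmonic_extension[OF A]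
  let ?h = "min_extension V E c A"
  have ex1: "\<exists>!h. energy_minimizing_extension V E c A \<phi> h" if "\<phi> \<in> A \<rightarrow>\<^sub>E UNIV" for \<phi>
    using minimizing_extension_exists[OF A \<open>A \<noteq> {}\<close> that] min_iff[OF that]
      harmonic_extension_unique[OF \<open>A \<subseteq> V\<close> \<open>A \<noteq> {}\<close>] by blast
  have harm: "harmonic_extension A \<phi> (?h \<phi>)" if "\<phi> \<in> A \<rightarrow>\<^sub>E UNIV" for \<phi>
    using theI'[OF ex1[OF that]] min_iff[OF that] by (simp add: min_extension_def)
  \<comment> \<open>By uniqueness, each linearity identity reduces to showing that its right-hand
    side is a harmonic extension of the combined boundary values.\<close>
  have eqI: "?h \<phi> = h" if "\<phi> \<in> A \<rightarrow>\<^sub>E UNIV" "harmonic_extension A \<phi> h" for \<phi> h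
    using harmonic_extension_unique[OF \<open>A \<subseteq> V\<close> \<open>A \<noteq> {}\<close> harm that(2)] that(1) .
  have fin: "fin_energy (?h \<phi>)" and on_A: "\<And>a. a \<in> A \<Longrightarrow> ?h \<phi> a = \<phi> a"
    and orth: "\<And>g. fin_energy g \<Longrightarrow> \<forall>a\<in>A. g a = 0 \<Longrightarrow> form (?h \<phi>) g = 0"
    if "\<phi> \<in> A \<rightarrow>\<^sub>E UNIV" for \<phi>
    using harm[OF that] by (simp_all add: harmonic_extension_def) (metis restrict_apply')
  show ?thesis
  proof (intro conjI ballI allI)
    fix \<phi> x assume \<phi>: "\<phi> \<in> A \<rightarrow>\<^sub>E (UNIV :: real set)" and x: "x \<in> V - A"
    show "discrete_harmonic_at E c (?h \<phi>) x"
      \<comment> \<open>The indicator of \<open>x\<close> is an admissible test function because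
        \<open>x\<close> lies outside \<open>A\<close>.\<close>
      using x by (intro harmonic_if_orthogonal fin[OF \<phi>] orth[OF \<phi>] finite_energy_indicator)
        (auto simp: indicator_def)
  next
    fix \<phi> assume \<phi>: "\<phi> \<in> A \<rightarrow>\<^sub>E (UNIV :: real set)"
    then show "dirichlet_energy E c (?h \<phi>) < \<infinity>" using fin by (simp add: dirichlet_energy_eq)
  next
    fix \<phi> \<psi> assume \<phi>: "\<phi> \<in> A \<rightarrow>\<^sub>E (UNIV :: real set)" and \<psi>: "\<psi> \<in> A \<rightarrow>\<^sub>E (UNIV :: real set)"
    let ?f = "\<lambda>x. ?h \<phi> x + ?h \<psi> x"
    have "harmonic_extension A (restrict ?f A) (restrict ?f V)"
      using \<open>A \<subseteq> V\<close> fin[OF \<phi>] fin[OF \<psi>] orth[OF \<phi>] orth[OF \<psi>]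
      by (intro harmonic_extension_restrict) (simp_all add: finite_energy_add form_add_left)
    moreover have "restrict ?f A = (\<lambda>x\<in>A. \<phi> x + \<psi> x)"
      using on_A \<phi> \<psi> by (auto intro: restrict_ext)
    ultimately show "?h (\<lambda>x\<in>A. \<phi> x + \<psi> x) = restrict ?f V" by (intro eqI) simp_all
  next
    fix r \<phi> assume \<phi>: "\<phi> \<in> A \<rightarrow>\<^sub>E (UNIV :: real set)"
    let ?f = "\<lambda>x. r * ?h \<phi> x"
    have "harmonic_extension A (restrict ?f A) (restrict ?f V)"
      using \<open>A \<subseteq> V\<close> fin[OF \<phi>] orth[OF \<phi>]
      by (intro harmonic_extension_restrict) (simp_all add: finite_energy_scale form_scale_left)
    moreover have "restrict ?f A = (\<lambda>x\<in>A. r * \<phi> x)"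
      using on_A \<phi> by (auto intro: restrict_ext)
    ultimately show "?h (\<lambda>x\<in>A. r * \<phi> x) = restrict ?f V" by (intro eqI) simp_all
  qed (rule ex1)
qed

end
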